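(* Let $(X,Y)$ be distributed according to the stationary distribution of the Markov process $(X(t),Y(t))_{t\ge0}$, and let $\boldsymbol e_k\in\mathbb R^d$ be the vector with entries $e_{i,k}:=\mathbb E\big((Y)_k\,1_{\{X=i\}}\big)$, $i=1,\dots,d$. For $k=1,\dots,N$, $$\boldsymbol e_k^{\rm T}=k!\,(N)_k\cdot\boldsymbol\pi^{\rm T}\Lambda(\Lambda+M-Q)^{-1}\Lambda(2\Lambda+2M-Q)^{-1}\cdots\Lambda(k\Lambda+kM-Q)^{-1},$$ whereas $\boldsymbol e_k^{\rm T}=0$ for $k=N+1,N+2,\dots$.
   Context: $(X(t))_{t\ge0}$ is an irreducible continuous-time Markov process on $\{1,\dots,d\}$ (the regime process) with transition rate matrix $Q=(q_{ij})_{i,j=1}^d$ and invariant distribution the column vector $\boldsymbol\pi$. There are $N$ possible edges; while $X(t)=i$, each absent edge becomes present at rate $\lambda_i\ge0$ and each present edge becomes absent at rate $\mu_i\ge0$, all edges reacting to the same regime process and otherwise evolving independently. $Y(t)\in\{0,\dots,N\}$ is the number of present edges at time $t$. Thus $(X(t),Y(t))$ is a Markov process with transitions $(i,m)\to(j,m)$ at rate $q_{ij}$ for $j\ne i$, $(i,m)\to(i,m+1)$ at rate $\lambda_i(N-m)$, and $(i,m)\to(i,m-1)$ at rate $\mu_im$. $\Lambda:=\mathrm{diag}\{\lambda_1,\dots,\lambda_d\}$, $M:=\mathrm{diag}\{\mu_1,\dots,\mu_d\}$, and $(x)_k:=x(x-1)\cdots(x-k+1)$. *)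

theory Defs
  imports "HOL-Probability.Probability"
begin

section \<open>Markov processes in continuous time on a finite state set\<close>

text \<open>
  A rate matrix is a function \<open>G x y\<close>, of which only the values for \<open>x\<close> and \<open>y\<close> in a
  finite set \<open>S\<close> of states matter.  The process with rate matrix \<open>G\<close> has the transition
  probabilities \<open>P\<^sub>t = exp (t G)\<close>, which are written out as a power series because matrices
  over a carrier set are not a type in the library.
\<close>

definition rate_matrix :: "'s set \<Rightarrow> ('s \<Rightarrow> 's \<Rightarrow> real) \<Rightarrow> bool" where
  "rate_matrix S G \<longleftrightarrow>
     (\<forall>x\<in>S. \<forall>y\<in>S. x \<noteq> y \<longrightarrow> 0 \<le> G x y) \<and> (\<forall>x\<in>S. (\<Sum>y\<in>S. G x y) = 0)"

definition irreducible_rates :: "'s set \<Rightarrow> ('s \<Rightarrow> 's \<Rightarrow> real) \<Rightarrow> bool" where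
  "irreducible_rates S G \<longleftrightarrow>
     (\<forall>x\<in>S. \<forall>y\<in>S. (x, y) \<in> {(u, v). u \<in> S \<and> v \<in> S \<and> u \<noteq> v \<and> 0 < G u v}\<^sup>*)"

text \<open>The rate matrix with jump rates \<open>r x y\<close> for \<open>x \<noteq> y\<close>; the values \<open>r x x\<close> are ignored.\<close>

definition rate_matrix_of_jumps :: "'s set \<Rightarrow> ('s \<Rightarrow> 's \<Rightarrow> real) \<Rightarrow> 's \<Rightarrow> 's \<Rightarrow> real" where
  "rate_matrix_of_jumps S r x y = (if x = y then - (\<Sum>z\<in>S - {x}. r x z) else r x y)"

primrec rate_power :: "'s set \<Rightarrow> ('s \<Rightarrow> 's \<Rightarrow> real) \<Rightarrow> nat \<Rightarrow> 's \<Rightarrow> 's \<Rightarrow> real" where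
  "rate_power S G 0 x y = (if x = y then 1 else 0)"
| "rate_power S G (Suc n) x y = (\<Sum>z\<in>S. G x z * rate_power S G n z y)"

definition transition_prob :: "'s set \<Rightarrow> ('s \<Rightarrow> 's \<Rightarrow> real) \<Rightarrow> real \<Rightarrow> 's \<Rightarrow> 's \<Rightarrow> real" where
  "transition_prob S G t x y = (\<Sum>n. t ^ n / fact n * rate_power S G n x y)"

text \<open>
  A distribution is given by its mass function, which is required to vanish outside \<open>S\<close> so that
  uniqueness can be expressed by equality of functions.
\<close>

definition stationary_distribution :: "'s set \<Rightarrow> ('s \<Rightarrow> 's \<Rightarrow> real) \<Rightarrow> ('s \<Rightarrow> real) \<Rightarrow> bool" where
  "stationary_distribution S G p \<longleftrightarrow>
     (\<forall>x\<in>S. 0 \<le> p x) \<and> (\<forall>x. x \<notin> S \<longrightarrow> p x = 0) \<and> (\<Sum>x\<in>S. p x) = 1 \<and>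
     (\<forall>t\<ge>0. \<forall>y\<in>S. (\<Sum>x\<in>S. p x * transition_prob S G t x y) = p y)"

section \<open>The number of edges under regime switching\<close>

definition joint_states :: "nat \<Rightarrow> ('d \<times> nat) set" where
  "joint_states N = UNIV \<times> {0..N}"

fun joint_jump_rate ::
  "real^'d^'d \<Rightarrow> real^'d \<Rightarrow> real^'d \<Rightarrow> nat \<Rightarrow> ('d \<times> nat) \<Rightarrow> ('d \<times> nat) \<Rightarrow> real" where
  "joint_jump_rate Q lam mu N (i, m) (j, n) =
     (if m = n \<and> j \<noteq> i then Q $ i $ j
      else if j = i \<and> n = m + 1 then lam $ i * (real N - real m)
      else if j = i \<and> m = n + 1 then mu $ i * real m
      else 0)"

definition joint_rate_matrix ::
  "real^'d^'d \<Rightarrow> real^'d \<Rightarrow> real^'d \<Rightarrow> nat \<Rightarrow> ('d \<times> nat) \<Rightarrow> ('d \<times> nat) \<Rightarrow> real" where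
  "joint_rate_matrix Q lam mu N =
     rate_matrix_of_jumps (joint_states N) (joint_jump_rate Q lam mu N)"

definition falling_factorial :: "real \<Rightarrow> nat \<Rightarrow> real" where
  "falling_factorial x k = (\<Prod>i<k. x - real i)"

definition factorial_moment_vector ::
  "'w measure \<Rightarrow> ('w \<Rightarrow> 'd) \<Rightarrow> ('w \<Rightarrow> nat) \<Rightarrow> nat \<Rightarrow> real^'d" where
  "factorial_moment_vector M X Y k =
     (\<chi> i. \<integral>\<omega>. falling_factorial (real (Y \<omega>)) k * indicator {i} (X \<omega>) \<partial>M)"

definition diag_mat :: "real^'d \<Rightarrow> real^'d^'d" where
  "diag_mat v = (\<chi> i j. if i = j then v $ i else 0)"

definition shifted_mat :: "real^'d^'d \<Rightarrow> real^'d \<Rightarrow> real^'d \<Rightarrow> nat \<Rightarrow> real^'d^'d" where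
  "shifted_mat Q lam mu k = real k *\<^sub>R diag_mat lam + real k *\<^sub>R diag_mat mu - Q"

primrec resolvent_product :: "real^'d^'d \<Rightarrow> real^'d \<Rightarrow> real^'d \<Rightarrow> nat \<Rightarrow> real^'d^'d" where
  "resolvent_product Q lam mu 0 = mat 1"
| "resolvent_product Q lam mu (Suc k) =
     resolvent_product Q lam mu k ** diag_mat lam ** matrix_inv (shifted_mat Q lam mu (Suc k))"

end

theory Submission
  imports Defs
begin

text \<open>
  A distribution \<open>p\<close> is stationary exactly when \<open>p G = 0\<close> for the rate matrix \<open>G\<close>, which is the same as
  saying that \<open>G f\<close> has mean zero under \<open>p\<close> for every function \<open>f\<close> on the states.  Take for \<open>f\<close> the
  function \<open>(m)\<^sub>k\<close> on regime \<open>i\<close> and zero on the other regimes.  The regime part of \<open>G\<close> contributes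
  \<open>(e\<^sub>k Q)\<^sub>i\<close>.  A birth changes \<open>(m)\<^sub>k\<close> by \<open>k (m)\<^sub>k\<^sub>-\<^sub>1\<close>, and
  \<open>(N - m) (m)\<^sub>k\<^sub>-\<^sub>1 = (N - k + 1) (m)\<^sub>k\<^sub>-\<^sub>1 - (m)\<^sub>k\<close>; a death at rate proportional to \<open>m\<close>
  contributes \<open>- k (m)\<^sub>k\<close>.  So the moment equations close at each order and read
  \<open>e\<^sub>k (k \<Lambda> + k M - Q) = k (N - k + 1) e\<^sub>k\<^sub>-\<^sub>1 \<Lambda>\<close> (lemma \<open>joint_moment_recursion\<close>).

  Solving this recursion requires two facts about the regime process.  The start \<open>e\<^sub>0\<close> is an invariant
  probability vector of \<open>Q\<close>, hence equal to \<open>\<pi>\<close> (\<open>invariant_vector_unique\<close>).  The matrix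
  \<open>k \<Lambda> + k M - Q\<close> is that of an irreducible process killed at rates \<open>k (\<lambda>\<^sub>i + \<mu>\<^sub>i)\<close>, so by the
  maximum principle it is invertible as soon as one of these rates is positive
  (\<open>invertible_diag_minus_rates\<close>).  If all of them were zero, the number of edges would never change
  and the joint process would have several stationary distributions (\<open>ex_positive_edge_rate\<close>).

  Above order \<open>N\<close> the moments vanish because \<open>(m)\<^sub>k = 0\<close> for \<open>m < k\<close>.
\<close>

section \<open>Stationarity and global balance\<close>

text \<open>A crude geometric bound; it makes the exponential series converge for all times.\<close>

lemma abs_rate_power_le:
  assumes "finite S" "x \<in> S"
  shows "\<bar>rate_power S G n x y\<bar> \<le> (\<Sum>u\<in>S. \<Sum>z\<in>S. \<bar>G u z\<bar>) ^ n"
  using assms(2)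
proof (induction n arbitrary: x)
  case 0
  then show ?case by simp
next
  case (Suc n)
  let ?B = "\<Sum>u\<in>S. \<Sum>z\<in>S. \<bar>G u z\<bar>"
  have "\<bar>rate_power S G (Suc n) x y\<bar> \<le> (\<Sum>z\<in>S. \<bar>G x z\<bar> * \<bar>rate_power S G n z y\<bar>)"
    by (simp add: sum_abs flip: abs_mult)
  also have "\<dots> \<le> (\<Sum>z\<in>S. \<bar>G x z\<bar> * ?B ^ n)"
    by (intro sum_mono mult_left_mono Suc.IH) auto
  also have "\<dots> = (\<Sum>z\<in>S. \<bar>G x z\<bar>) * ?B ^ n"
    by (simp add: sum_distrib_right)
  also have "\<dots> \<le> ?B * ?B ^ n"
    using assms(1) Suc.prems
    by (intro mult_right_mono member_le_sum[of x S "\<lambda>u. \<Sum>z\<in>S. \<bar>G u z\<bar>"])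
       (auto intro!: sum_nonneg zero_le_power)
  finally show ?case by simp
qed

lemma summable_transition_series:
  assumes "finite S" "x \<in> S"
  shows "summable (\<lambda>n. t ^ n / fact n * rate_power S G n x y)"
proof (rule summable_comparison_test)
  let ?B = "\<Sum>u\<in>S. \<Sum>z\<in>S. \<bar>G u z\<bar>"
  show "summable (\<lambda>n. (\<bar>t\<bar> * ?B) ^ n / fact n)"
    using summable_exp_generic[of "\<bar>t\<bar> * ?B"] by (simp add: field_simps)
  have "norm (t ^ n / fact n * rate_power S G n x y) \<le> (\<bar>t\<bar> * ?B) ^ n / fact n" for n
  proof -
    have "norm (t ^ n / fact n * rate_power S G n x y)
        = \<bar>t\<bar> ^ n / fact n * \<bar>rate_power S G n x y\<bar>"
      by (simp add: abs_mult power_abs)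
    also have "\<dots> \<le> \<bar>t\<bar> ^ n / fact n * ?B ^ n"
      by (intro mult_left_mono abs_rate_power_le assms) auto
    finally show ?thesis by (simp add: power_mult_distrib)
  qed
  then show "\<exists>N. \<forall>n\<ge>N. norm (t ^ n / fact n * rate_power S G n x y) \<le> (\<bar>t\<bar> * ?B) ^ n / fact n"
    by blast
qed

lemma transition_average_sums:
  assumes "finite S"
  shows "(\<lambda>n. (\<Sum>x\<in>S. p x * rate_power S G n x y) / fact n * t ^ n) sums
           (\<Sum>x\<in>S. p x * transition_prob S G t x y)"
proof -
  have "(\<lambda>n. \<Sum>x\<in>S. p x * (t ^ n / fact n * rate_power S G n x y)) sums
          (\<Sum>x\<in>S. p x * transition_prob S G t x y)"
    unfolding transition_prob_def
    by (intro sums_sum sums_mult summable_sums summable_transition_series assms)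
  moreover have "(\<Sum>x\<in>S. p x * (t ^ n / fact n * rate_power S G n x y))
      = (\<Sum>x\<in>S. p x * rate_power S G n x y) / fact n * t ^ n" for n
    unfolding sum_divide_distrib sum_distrib_right by (rule sum.cong) auto
  ultimately show ?thesis by simp
qed

lemma rate_power_1:
  assumes "finite S" "y \<in> S"
  shows "rate_power S G (Suc 0) x y = G x y"
proof -
  have "rate_power S G (Suc 0) x y = (\<Sum>z\<in>S. if z = y then G x z else 0)"
    by (auto intro!: sum.cong)
  then show ?thesis using assms by simp
qed

text \<open>
  The map \<open>t \<mapsto> p exp (t G)\<close> is a power series whose linear coefficient is \<open>p G\<close>.  If it is constant
  for \<open>t \<ge> 0\<close>, its derivative at \<open>0\<close> vanishes, so \<open>p G = 0\<close>; and if \<open>p G = 0\<close>, then every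
  coefficient except the constant one vanishes.
\<close>

lemma stationary_distribution_iff_balance:
  assumes "finite S"
  shows "stationary_distribution S G p \<longleftrightarrow>
     (\<forall>x\<in>S. 0 \<le> p x) \<and> (\<forall>x. x \<notin> S \<longrightarrow> p x = 0) \<and> (\<Sum>x\<in>S. p x) = 1 \<and>
     (\<forall>y\<in>S. (\<Sum>x\<in>S. p x * G x y) = 0)"
proof -
  let ?c = "\<lambda>y n. (\<Sum>x\<in>S. p x * rate_power S G n x y) / fact n"
  let ?f = "\<lambda>y t. \<Sum>x\<in>S. p x * transition_prob S G t x y"
  have sums: "(\<lambda>n. ?c y n * t ^ n) sums ?f y t" for y t
    using transition_average_sums[OF assms] .
  have "(\<Sum>x\<in>S. p x * G x y) = 0" if y: "y \<in> S" and const: "\<forall>t\<ge>0. ?f y t = p y" for y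
  proof -
    have "((\<lambda>t. \<Sum>n. ?c y n * t ^ n) has_real_derivative (\<Sum>n. diffs (?c y) n * 0 ^ n)) (at 0)"
      by (rule termdiffs_strong_converges_everywhere) (use sums in \<open>blast intro: sums_summable\<close>)
    moreover have "(\<Sum>n. diffs (?c y) n * 0 ^ n) = ?c y 1"
      unfolding powser_zero by (simp add: diffs_def)
    moreover have "(\<lambda>t. \<Sum>n. ?c y n * t ^ n) = ?f y"
      using sums_unique[OF sums, symmetric] by (rule ext)
    ultimately have "(?f y has_real_derivative ?c y 1) (at 0)"
      by (simp only:)
    then have deriv: "(?f y has_real_derivative ?c y 1) (at 0 within {0..})"
      by (rule has_field_derivative_at_within)
    have "((\<lambda>t. p y) has_real_derivative 0) (at 0 within {0::real..})"
      by simp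
    then have "(?f y has_real_derivative 0) (at 0 within {0..})"
      by (rule has_field_derivative_transform_within[where d = 1]) (use const in auto)
    with deriv have "?c y 1 = 0"
      by (rule has_field_derivative_unique) (simp add: at_within_Ici_at_right)
    then show ?thesis
      using rate_power_1[OF assms y, of G] by simp
  qed
  moreover have "?f y t = p y"
    if balance: "\<forall>y\<in>S. (\<Sum>x\<in>S. p x * G x y) = 0" and y: "y \<in> S" for y t
  proof -
    have coeff: "?c y (Suc n) = 0" for n
    proof -
      have "(\<Sum>x\<in>S. p x * rate_power S G (Suc n) x y)
          = (\<Sum>z\<in>S. (\<Sum>x\<in>S. p x * G x z) * rate_power S G n z y)"
        by (simp add: sum_distrib_left sum_distrib_right mult.assoc) (rule sum.swap)
      then show ?thesis using balance by simp
    qed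
    have "(\<Sum>x\<in>S. p x * rate_power S G 0 x y) = (\<Sum>x\<in>S. if x = y then p x else 0)"
      by (auto intro!: sum.cong)
    then have "?c y 0 = p y"
      using assms y by simp
    then have "(\<lambda>n. ?c y n * t ^ n) = (\<lambda>n. if n = 0 then p y else 0)"
      using coeff by (auto simp: fun_eq_iff gr0_conv_Suc simp del: rate_power.simps)
    then have "(\<lambda>n. ?c y n * t ^ n) sums p y"
      using sums_single[of 0 "\<lambda>_. p y"] by simp
    then show ?thesis
      using sums sums_unique2 by blast
  qed
  ultimately show ?thesis
    unfolding stationary_distribution_def by blast
qed

section \<open>Irreducible rate matrices\<close>

text \<open>
  A maximum principle.  At a state where \<open>v\<close> attains a positive maximum, the left side of the
  equation is nonnegative and the right side is a sum of nonpositive terms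
  \<open>Q i j (v j - v i)\<close>.  Hence both vanish and the maximum is also attained at every state
  that can be entered from there; by irreducibility \<open>v\<close> is constant and \<open>c\<close> vanishes everywhere, contrary to \<open>c a > 0\<close>.
\<close>

lemma killed_harmonic_nonpos:
  fixes Q :: "real^'d^'d" and c v :: "real^'d"
  assumes rate: "rate_matrix UNIV (\<lambda>i j. Q $ i $ j)"
    and irred: "irreducible_rates UNIV (\<lambda>i j. Q $ i $ j)"
    and c: "\<And>i. 0 \<le> c $ i" "0 < c $ a"
    and eq: "\<And>i. c $ i * v $ i = (\<Sum>j\<in>UNIV. Q $ i $ j * v $ j)"
  shows "v $ i \<le> 0"
proof (rule ccontr)
  assume "\<not> v $ i \<le> 0"
  define m where "m = Max (range (($) v))"
  have le: "v $ j \<le> m" for j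
    unfolding m_def by (rule Max_ge) auto
  have "m \<in> range (($) v)"
    unfolding m_def by (rule Max_in) auto
  then obtain b where b: "v $ b = m" by auto
  have m: "0 < m" using le[of i] \<open>\<not> v $ i \<le> 0\<close> by linarith
  have at_max: "c $ x = 0 \<and> (\<forall>y. x \<noteq> y \<and> 0 < Q $ x $ y \<longrightarrow> v $ y = m)" if x: "v $ x = m" for x
  proof -
    let ?g = "\<lambda>j. Q $ x $ j * (m - v $ j)"
    have "(\<Sum>j\<in>UNIV. ?g j) = (\<Sum>j\<in>UNIV. Q $ x $ j) * m - (\<Sum>j\<in>UNIV. Q $ x $ j * v $ j)"
      by (simp add: right_diff_distrib sum_subtractf sum_distrib_right)
    then have sum: "(\<Sum>j\<in>UNIV. ?g j) = - (c $ x * m)"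
      using eq[of x] rate x by (simp add: rate_matrix_def)
    have g: "0 \<le> ?g j" for j
      using rate le[of j] x by (cases "j = x") (auto simp: rate_matrix_def)
    then have "0 \<le> (\<Sum>j\<in>UNIV. ?g j)" by (simp add: sum_nonneg)
    moreover have "0 \<le> c $ x * m" using c(1)[of x] m by simp
    ultimately have "(\<Sum>j\<in>UNIV. ?g j) = 0" and cx: "c $ x = 0" using sum m by auto
    then have "?g y = 0" for y
      using g sum_nonneg_eq_0_iff[of UNIV ?g] by simp
    then show ?thesis using cx by force
  qed
  have "(b, a) \<in> {(u, w). u \<in> UNIV \<and> w \<in> UNIV \<and> u \<noteq> w \<and> 0 < Q $ u $ w}\<^sup>*"
    using irred by (simp add: irreducible_rates_def)
  then have "v $ a = m"
    by (induction rule: rtrancl_induct) (use b at_max in auto)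
  then show False using at_max[of a] c(2) by simp
qed

lemma invertible_diag_minus_rates:
  fixes Q :: "real^'d^'d"
  assumes rate: "rate_matrix UNIV (\<lambda>i j. Q $ i $ j)"
    and irred: "irreducible_rates UNIV (\<lambda>i j. Q $ i $ j)"
    and c: "\<And>i. 0 \<le> c $ i" "0 < c $ a"
  shows "invertible (diag_mat c - Q)"
proof -
  have "v = 0" if "(diag_mat c - Q) *v v = 0" for v
  proof -
    have eq: "c $ i * v $ i = (\<Sum>j\<in>UNIV. Q $ i $ j * v $ j)" for i
    proof -
      have "0 = ((diag_mat c - Q) *v v) $ i" using that by simp
      also have "\<dots> = (\<Sum>j\<in>UNIV. (if i = j then c $ i * v $ j else 0) - Q $ i $ j * v $ j)"
        by (auto simp: matrix_vector_mult_def diag_mat_def left_diff_distrib intro!: sum.cong)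
      also have "\<dots> = c $ i * v $ i - (\<Sum>j\<in>UNIV. Q $ i $ j * v $ j)"
        by (simp add: sum_subtractf)
      finally show ?thesis by simp
    qed
    have "v $ i \<le> 0" for i
      using eq by (rule killed_harmonic_nonpos[OF rate irred c])
    moreover have "(- v) $ i \<le> 0" for i
      by (rule killed_harmonic_nonpos[OF rate irred c]) (simp add: eq sum_negf)
    ultimately show "v = 0"
      by (simp add: vec_eq_iff order_antisym)
  qed
  then show ?thesis
    by (metis invertible_left_inverse matrix_left_invertible_ker)
qed

lemma shifted_mat_eq: "shifted_mat Q lam mu k = diag_mat (real k *\<^sub>R (lam + mu)) - Q"
  by (simp add: shifted_mat_def diag_mat_def vec_eq_iff distrib_left)

lemma vector_mult_diag_mat: "(v v* diag_mat c) $ i = v $ i * c $ i"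
  by (simp add: vector_matrix_mult_def diag_mat_def if_distrib cong: if_cong)

lemma matrix_inv_right:
  fixes A :: "real^'d^'d"
  assumes "invertible A"
  shows "A ** matrix_inv A = mat 1"
  using someI_ex[OF assms[unfolded invertible_def]] by (simp add: matrix_inv_def)

lemma vector_mult_invertible_eq_0:
  fixes A :: "real^'d^'d"
  assumes "invertible A" "v v* A = 0"
  shows "v = 0"
  by (metis assms matrix_inv_right vector_matrix_mul_assoc vector_matrix_mul_rid
      vector_matrix_mult_0)

text \<open>
  With killing added at the single state \<open>a\<close>, the matrix becomes invertible.  The vector
  \<open>q\<^sub>a p - p\<^sub>a q\<close> is annihilated by \<open>Q\<close> and vanishes at \<open>a\<close>, so it is annihilated by the killed
  matrix and is zero.  Summing its entries gives \<open>q\<^sub>a = p\<^sub>a\<close>.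
\<close>

lemma invariant_vector_unique:
  fixes Q :: "real^'d^'d" and p q :: "real^'d"
  assumes rate: "rate_matrix UNIV (\<lambda>i j. Q $ i $ j)"
    and irred: "irreducible_rates UNIV (\<lambda>i j. Q $ i $ j)"
    and p: "p v* Q = 0" "(\<Sum>i\<in>UNIV. p $ i) = 1"
    and q: "q v* Q = 0" "(\<Sum>i\<in>UNIV. q $ i) = 1"
  shows "p = q"
proof -
  have "p $ a = q $ a" for a
  proof -
    define w where "w = q $ a *\<^sub>R p - p $ a *\<^sub>R q"
    have "invertible (diag_mat (axis a 1) - Q)"
      by (rule invertible_diag_minus_rates[OF rate irred, of _ a]) (auto simp: axis_def)
    moreover have "w v* (diag_mat (axis a 1) - Q) = 0"
    proof -
      have "w v* diag_mat (axis a 1) = 0"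
        by (auto simp: vec_eq_iff vector_mult_diag_mat w_def axis_def)
      moreover have "w v* Q = 0"
        using p(1) q(1)
        by (simp add: w_def vector_matrix_mult_diff_distrib scaleR_vector_matrix_assoc)
      ultimately show ?thesis
        by (simp add: vector_matrix_mult_diff_rdistrib)
    qed
    ultimately have "w = 0" by (rule vector_mult_invertible_eq_0)
    then have "0 = (\<Sum>i\<in>UNIV. w $ i)" by simp
    also have "\<dots> = q $ a * (\<Sum>i\<in>UNIV. p $ i) - p $ a * (\<Sum>i\<in>UNIV. q $ i)"
      by (simp add: w_def sum_subtractf sum_distrib_left)
    finally show ?thesis using p q by simp
  qed
  then show ?thesis by (simp add: vec_eq_iff)
qed

section \<open>The generator of regime and edge count\<close>

lemma sum_rate_matrix_of_jumps:
  assumes "finite S" "x \<in> S"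
  shows "(\<Sum>y\<in>S. rate_matrix_of_jumps S r x y * f y) = (\<Sum>y\<in>S - {x}. r x y * (f y - f x))"
proof -
  have "(\<Sum>y\<in>S. rate_matrix_of_jumps S r x y * f y)
      = rate_matrix_of_jumps S r x x * f x + (\<Sum>y\<in>S - {x}. rate_matrix_of_jumps S r x y * f y)"
    using assms by (rule sum.remove)
  also have "(\<Sum>y\<in>S - {x}. rate_matrix_of_jumps S r x y * f y) = (\<Sum>y\<in>S - {x}. r x y * f y)"
    by (rule sum.cong) (auto simp: rate_matrix_of_jumps_def)
  finally show ?thesis
    by (simp add: rate_matrix_of_jumps_def right_diff_distrib sum_subtractf sum_distrib_right)
qed

lemma finite_joint_states: "finite (joint_states N :: ('d::finite \<times> nat) set)"
  by (simp add: joint_states_def)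

lemma sum_joint_states:
  "(\<Sum>s\<in>joint_states N. g s) = (\<Sum>j\<in>(UNIV::'d::finite set). \<Sum>m\<le>N. g (j, m))"
  by (simp add: joint_states_def sum.cartesian_product atLeast0AtMost)

text \<open>
  The right side also evaluates \<open>f\<close> beyond the ends of \<open>{0..N}\<close>: at \<open>N + 1\<close>, and at \<open>0 - 1\<close>, which is
  \<open>0\<close> in the natural numbers.  There the birth rate \<open>N - N\<close> and the death rate \<open>0\<close> vanish, so the
  formula needs no boundary cases.
\<close>

lemma joint_generator:
  fixes Q :: "real^'d^'d"
  assumes rate: "rate_matrix UNIV (\<lambda>i j. Q $ i $ j)" and m: "m \<le> N"
  shows "(\<Sum>y\<in>joint_states N. joint_rate_matrix Q lam mu N (i, m) y * f y) =
     (\<Sum>j\<in>UNIV. Q $ i $ j * f (j, m))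
     + lam $ i * (real N - real m) * (f (i, m + 1) - f (i, m))
     + mu $ i * real m * (f (i, m - 1) - f (i, m))"
proof -
  let ?r = "joint_jump_rate Q lam mu N (i, m)"
  let ?d = "\<lambda>y. f y - f (i, m)"
  have im: "(i, m) \<in> joint_states N" using m by (simp add: joint_states_def)
  have "(\<Sum>y\<in>joint_states N. joint_rate_matrix Q lam mu N (i, m) y * f y)
      = (\<Sum>y\<in>joint_states N - {(i, m)}. ?r y * ?d y)"
    unfolding joint_rate_matrix_def by (rule sum_rate_matrix_of_jumps[OF finite_joint_states im])
  also have "\<dots> = (\<Sum>y\<in>joint_states N. ?r y * ?d y)"
    by (rule sum.mono_neutral_left) (auto simp: finite_joint_states)
  also have "\<dots> = (\<Sum>j\<in>UNIV. \<Sum>n\<le>N.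
        (if n = m then Q $ i $ j * ?d (j, n) else 0)
      + (if n = m + 1 then if j = i then lam $ i * (real N - real m) * ?d (j, n) else 0 else 0)
      + (if n = m - 1 then if j = i then mu $ i * real m * ?d (j, n) else 0 else 0))"
    unfolding sum_joint_states by (intro sum.cong refl) (auto split: if_splits)
  also have "\<dots> = (\<Sum>j\<in>UNIV. Q $ i $ j * ?d (j, m))
      + (if m + 1 \<le> N then lam $ i * (real N - real m) * ?d (i, m + 1) else 0)
      + mu $ i * real m * ?d (i, m - 1)"
  proof -
    have "m - 1 \<le> N" using m by simp
    then show ?thesis
      using m by (simp add: sum.distrib if_distrib[of "sum _"] cong: if_cong)
  qed
  also have "(if m + 1 \<le> N then lam $ i * (real N - real m) * ?d (i, m + 1) else 0)
      = lam $ i * (real N - real m) * ?d (i, m + 1)"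
    using m by (cases "m = N") auto
  also have "(\<Sum>j\<in>UNIV. Q $ i $ j * ?d (j, m))
      = (\<Sum>j\<in>UNIV. Q $ i $ j * f (j, m)) - (\<Sum>j\<in>UNIV. Q $ i $ j) * f (i, m)"
    by (simp add: right_diff_distrib sum_subtractf sum_distrib_right)
  finally show ?thesis using rate by (simp add: rate_matrix_def)
qed

text \<open>
  Without edge rates the generator acts on the regime alone, so \<open>\<pi>\<close> placed on any single edge
  count is balanced.
\<close>

lemma stationary_constant_edge_count:
  fixes Q :: "real^'d^'d" and pi_vec :: "real^'d"
  assumes rate: "rate_matrix UNIV (\<lambda>i j. Q $ i $ j)"
    and stat: "stationary_distribution UNIV (\<lambda>i j. Q $ i $ j) (\<lambda>i. pi_vec $ i)"
    and zero: "\<And>i. lam $ i = 0" "\<And>i. mu $ i = 0"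
    and a: "a \<le> N"
  shows "stationary_distribution (joint_states N) (joint_rate_matrix Q lam mu N)
           (\<lambda>(i, m). if m = a then pi_vec $ i else 0)"
proof -
  let ?p = "\<lambda>(i, m). if m = a then pi_vec $ i else 0"
  have pi: "\<And>i. 0 \<le> pi_vec $ i" "(\<Sum>i\<in>UNIV. pi_vec $ i) = 1"
    "\<And>j. (\<Sum>i\<in>UNIV. pi_vec $ i * Q $ i $ j) = 0"
    using stat by (auto simp: stationary_distribution_iff_balance)
  have "(\<Sum>x\<in>joint_states N. ?p x * joint_rate_matrix Q lam mu N x (j, n)) = 0"
    if n: "(j, n) \<in> joint_states N" for j n
  proof -
    \<comment> \<open>An entry of the rate matrix is the generator applied to the indicator of its column.\<close>
    have rates: "joint_rate_matrix Q lam mu N (i, a) (j, n) = (if n = a then Q $ i $ j else 0)" for i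
    proof -
      have "joint_rate_matrix Q lam mu N (i, a) (j, n)
          = (\<Sum>y\<in>joint_states N. joint_rate_matrix Q lam mu N (i, a) y * (if y = (j, n) then 1 else 0))"
        using n by (simp add: if_distrib finite_joint_states cong: if_cong)
      also have "\<dots> = (\<Sum>j'\<in>UNIV. Q $ i $ j' * (if (j', a) = (j, n) then 1 else 0))"
        using joint_generator[OF rate a, of lam mu i "\<lambda>y. if y = (j, n) then 1 else 0"]
        by (simp add: zero)
      also have "\<dots> = (if n = a then Q $ i $ j else 0)"
        by (auto simp: if_distrib cong: if_cong)
      finally show ?thesis .
    qed
    have "(\<Sum>x\<in>joint_states N. ?p x * joint_rate_matrix Q lam mu N x (j, n))
        = (\<Sum>i\<in>UNIV. pi_vec $ i * joint_rate_matrix Q lam mu N (i, a) (j, n))"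
      unfolding sum_joint_states using a
      by (simp add: if_distrib[of "\<lambda>x. x * _"] cong: if_cong)
    also have "\<dots> = 0"
      unfolding rates using pi(3)[of j] by (cases "n = a") simp_all
    finally show ?thesis .
  qed
  then show ?thesis
    unfolding stationary_distribution_iff_balance[OF finite_joint_states]
    using pi a by (auto simp: sum_joint_states) (auto simp: joint_states_def)
qed

text \<open>
  This is where uniqueness of the joint stationary distribution enters: without any edge rate,
  the edge counts \<open>0\<close> and \<open>1\<close> would give two different stationary distributions.
\<close>

lemma ex_positive_edge_rate:
  fixes Q :: "real^'d^'d" and pi_vec :: "real^'d"
  assumes rate: "rate_matrix UNIV (\<lambda>i j. Q $ i $ j)"
    and stat: "stationary_distribution UNIV (\<lambda>i j. Q $ i $ j) (\<lambda>i. pi_vec $ i)"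
    and nonneg: "\<And>i. 0 \<le> lam $ i" "\<And>i. 0 \<le> mu $ i"
    and uniq: "\<exists>!p. stationary_distribution (joint_states N) (joint_rate_matrix Q lam mu N) p"
    and N: "1 \<le> N"
  shows "\<exists>a. 0 < lam $ a + mu $ a"
proof (rule ccontr)
  assume "\<not> ?thesis"
  then have le: "lam $ i + mu $ i \<le> 0" for i by (simp add: not_less)
  have zero: "lam $ i = 0" "mu $ i = 0" for i
    using nonneg(1)[of i] nonneg(2)[of i] le[of i] by linarith+
  obtain q where
    q: "stationary_distribution (joint_states N) (joint_rate_matrix Q lam mu N) p \<Longrightarrow> p = q" for p
    using uniq by (elim ex1E) blast
  have "(\<lambda>(i, m). if m = 0 then pi_vec $ i else 0) = q"
    by (rule q, rule stationary_constant_edge_count[OF rate stat zero]) simp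
  moreover have "(\<lambda>(i, m). if m = 1 then pi_vec $ i else 0) = q"
    by (rule q, rule stationary_constant_edge_count[OF rate stat zero N])
  ultimately have
    "(\<lambda>(i, m). if m = (0::nat) then pi_vec $ i else 0) = (\<lambda>(i, m). if m = 1 then pi_vec $ i else 0)"
    by simp
  then have "pi_vec $ i = 0" for i
    by (auto dest: fun_cong[where x = "(i, 0)"])
  then show False
    using stat by (simp add: stationary_distribution_def)
qed

section \<open>Factorial moments\<close>

lemma falling_factorial_0: "falling_factorial x 0 = 1"
  by (simp add: falling_factorial_def)

lemma falling_factorial_Suc:
  "falling_factorial x (Suc k) = falling_factorial x k * (x - real k)"
  by (simp add: falling_factorial_def)

lemma falling_factorial_shift:
  "falling_factorial (x + 1) (Suc k) = (x + 1) * falling_factorial x k"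
  unfolding falling_factorial_def prod.lessThan_Suc_shift by simp

lemma falling_factorial_eq_0:
  assumes "m < k"
  shows "falling_factorial (real m) k = 0"
  unfolding falling_factorial_def by (rule prod_zero) (use assms in auto)

text \<open>
  The birth rate \<open>N - x\<close> would raise the degree of the increment \<open>(k + 1) (x)\<^sub>k\<close>; splitting it as
  \<open>(N - k) - (x - k)\<close> turns the product into a combination of \<open>(x)\<^sub>k\<close> and \<open>(x)\<^sub>k\<^sub>+\<^sub>1\<close>.  This is what
  makes the moment equations close.
\<close>

lemma falling_factorial_birth:
  "(N - x) * (falling_factorial (x + 1) (Suc k) - falling_factorial x (Suc k))
    = real (Suc k) * ((N - real k) * falling_factorial x k - falling_factorial x (Suc k))"
  unfolding falling_factorial_shift unfolding falling_factorial_Suc by (simp add: algebra_simps)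

lemma falling_factorial_death:
  "x * (falling_factorial (x - 1) (Suc k) - falling_factorial x (Suc k))
    = - real (Suc k) * falling_factorial x (Suc k)"
  using falling_factorial_shift[of "x - 1" k]
  by (simp add: falling_factorial_Suc[of "x - 1"] algebra_simps)

text \<open>
  The vector \<open>e\<^sub>k\<close> in terms of the mass function alone, a finite sum to which the balance equations
  apply.
\<close>

definition joint_moment :: "nat \<Rightarrow> ('d::finite \<times> nat \<Rightarrow> real) \<Rightarrow> nat \<Rightarrow> real^'d" where
  "joint_moment N p k = (\<chi> i. \<Sum>m\<le>N. p (i, m) * falling_factorial (real m) k)"

lemma joint_moment_eq_0:
  assumes "N < k"
  shows "joint_moment N p k = 0"
  using assms by (auto simp: joint_moment_def vec_eq_iff falling_factorial_eq_0 intro!: sum.neutral)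

lemma balance_generator_expectation:
  assumes "\<forall>y\<in>S. (\<Sum>x\<in>S. p x * G x y) = (0::real)"
  shows "(\<Sum>x\<in>S. p x * (\<Sum>y\<in>S. G x y * f y)) = 0"
proof -
  have "(\<Sum>x\<in>S. p x * (\<Sum>y\<in>S. G x y * f y)) = (\<Sum>y\<in>S. (\<Sum>x\<in>S. p x * G x y) * f y)"
    by (simp add: sum_distrib_left sum_distrib_right mult.assoc) (rule sum.swap)
  then show ?thesis using assms by simp
qed

text \<open>
  Under a balanced \<open>p\<close> the generator has mean zero.  Applied to \<open>(m)\<^sub>k\<close> times the indicator of
  regime \<open>i\<close>, this gives the moment equations; order \<open>0\<close> says that the regime marginal is invariant.
\<close>

lemma joint_moment_balance:
  fixes Q :: "real^'d^'d"
  assumes rate: "rate_matrix UNIV (\<lambda>i j. Q $ i $ j)"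
    and bal: "\<forall>y\<in>joint_states N. (\<Sum>x\<in>joint_states N. p x * joint_rate_matrix Q lam mu N x y) = 0"
  shows "(joint_moment N p k v* Q) $ i
     + (\<Sum>m\<le>N. p (i, m) *
         (lam $ i * ((real N - real m)
            * (falling_factorial (real m + 1) k - falling_factorial (real m) k))
          + mu $ i * (real m
            * (falling_factorial (real m - 1) k - falling_factorial (real m) k)))) = 0"
proof -
  let ?F = "\<lambda>x. falling_factorial x k"
  let ?f = "\<lambda>(j, m). if j = i then ?F (real m) else 0"
  let ?B = "\<lambda>m. lam $ i * ((real N - real m) * (?F (real m + 1) - ?F (real m)))
              + mu $ i * (real m * (?F (real m - 1) - ?F (real m)))"
  have gen: "(\<Sum>y\<in>joint_states N. joint_rate_matrix Q lam mu N (j, m) y * ?f y)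
      = Q $ j $ i * ?F (real m) + (if j = i then ?B m else 0)" if m: "m \<le> N" for j m
  proof -
    have "(\<Sum>j'\<in>UNIV. Q $ j $ j' * ?f (j', m)) = Q $ j $ i * ?F (real m)"
      by (simp add: if_distrib cong: if_cong)
    moreover have "real m * ?F (real (m - 1)) = real m * ?F (real m - 1)"
      by (cases m) auto
    ultimately show ?thesis
      unfolding joint_generator[OF rate m] by (auto simp: algebra_simps)
  qed
  have "0 = (\<Sum>x\<in>joint_states N. p x * (\<Sum>y\<in>joint_states N. joint_rate_matrix Q lam mu N x y * ?f y))"
    by (rule balance_generator_expectation[OF bal, symmetric])
  also have "\<dots> = (\<Sum>j\<in>UNIV. \<Sum>m\<le>N.
      p (j, m) * (Q $ j $ i * ?F (real m) + (if j = i then ?B m else 0)))"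
    by (subst sum_joint_states) (intro sum.cong refl arg_cong2[where f = "(*)"] gen, auto)
  also have "\<dots> = (\<Sum>j\<in>UNIV. \<Sum>m\<le>N. p (j, m) * (Q $ j $ i * ?F (real m)))
      + (\<Sum>j\<in>UNIV. if j = i then \<Sum>m\<le>N. p (j, m) * ?B m else 0)"
    unfolding sum.distrib[symmetric] by (intro sum.cong refl) (auto simp: distrib_left sum.distrib)
  also have "(\<Sum>j\<in>UNIV. if j = i then \<Sum>m\<le>N. p (j, m) * ?B m else 0) = (\<Sum>m\<le>N. p (i, m) * ?B m)"
    by simp
  also have "(\<Sum>j\<in>UNIV. \<Sum>m\<le>N. p (j, m) * (Q $ j $ i * ?F (real m))) = (joint_moment N p k v* Q) $ i"
    by (simp add: vector_matrix_mult_def joint_moment_def sum_distrib_left mult_ac)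
  finally show ?thesis by simp
qed

lemma joint_moment_0_invariant:
  fixes Q :: "real^'d^'d"
  assumes "rate_matrix UNIV (\<lambda>i j. Q $ i $ j)"
    and "\<forall>y\<in>joint_states N. (\<Sum>x\<in>joint_states N. p x * joint_rate_matrix Q lam mu N x y) = 0"
  shows "joint_moment N p 0 v* Q = 0"
  using joint_moment_balance[OF assms, of 0] by (simp add: vec_eq_iff falling_factorial_0)

lemma joint_moment_recursion:
  fixes Q :: "real^'d^'d"
  assumes "rate_matrix UNIV (\<lambda>i j. Q $ i $ j)"
    and "\<forall>y\<in>joint_states N. (\<Sum>x\<in>joint_states N. p x * joint_rate_matrix Q lam mu N x y) = 0"
  shows "joint_moment N p (Suc k) v* shifted_mat Q lam mu (Suc k) =
     (real (Suc k) * (real N - real k)) *\<^sub>R (joint_moment N p k v* diag_mat lam)"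
proof -
  let ?e = "joint_moment N p"
  have "(?e (Suc k) v* shifted_mat Q lam mu (Suc k)) $ i =
     real (Suc k) * (real N - real k) * (?e k $ i * lam $ i)" for i
  proof -
    have "(\<Sum>m\<le>N. p (i, m) *
         (lam $ i * ((real N - real m)
            * (falling_factorial (real m + 1) (Suc k) - falling_factorial (real m) (Suc k)))
          + mu $ i * (real m
            * (falling_factorial (real m - 1) (Suc k) - falling_factorial (real m) (Suc k)))))
       = real (Suc k) * (real N - real k) * (?e k $ i * lam $ i)
          - real (Suc k) * (lam $ i + mu $ i) * ?e (Suc k) $ i"
      unfolding falling_factorial_birth falling_factorial_death joint_moment_def
      by (simp add: sum_distrib_left sum_distrib_right sum_subtractf[symmetric] del: of_nat_Suc)
         (simp add: algebra_simps del: of_nat_Suc)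
    moreover have "(?e (Suc k) v* shifted_mat Q lam mu (Suc k)) $ i
        = real (Suc k) * (lam $ i + mu $ i) * ?e (Suc k) $ i - (?e (Suc k) v* Q) $ i"
    unfolding shifted_mat_eq
      by (simp add: vector_matrix_mult_diff_rdistrib vector_mult_diag_mat)
    ultimately show ?thesis
      using joint_moment_balance[OF assms, of "Suc k" i] by simp
  qed
  then show ?thesis by (simp add: vec_eq_iff vector_mult_diag_mat)
qed

text \<open>A distribution whose mass on \<open>S\<close> is one puts no mass elsewhere, so expectations are sums over \<open>S\<close>.\<close>

lemma factorial_moment_vector_eq_joint_moment:
  fixes X :: "'w \<Rightarrow> 'd::finite" and Y :: "'w \<Rightarrow> nat"
  assumes "prob_space M"
    and X: "X \<in> measurable M (count_space UNIV)" and Y: "Y \<in> measurable M (count_space UNIV)"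
    and mass: "(\<Sum>s\<in>joint_states N. measure M {\<omega> \<in> space M. (X \<omega>, Y \<omega>) = s}) = 1"
  shows "factorial_moment_vector M X Y k =
     joint_moment N (\<lambda>s. measure M {\<omega> \<in> space M. (X \<omega>, Y \<omega>) = s}) k"
proof -
  interpret prob_space M by fact
  let ?A = "\<lambda>s. {\<omega> \<in> space M. (X \<omega>, Y \<omega>) = s}"
  let ?S = "joint_states N :: ('d \<times> nat) set"
  have A: "?A s \<in> events" for s
  proof -
    obtain i m where s: "s = (i, m)" by (cases s)
    have "?A s = (X -` {i} \<inter> space M) \<inter> (Y -` {m} \<inter> space M)"
      by (auto simp: s)
    then show ?thesis
      using measurable_sets[OF X, of "{i}"] measurable_sets[OF Y, of "{m}"] by auto
  qed
  have "prob (\<Union>s\<in>?S. ?A s) = (\<Sum>s\<in>?S. prob (?A s))"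
    by (rule finite_measure_finite_Union[OF finite_joint_states])
       (auto simp: A disjoint_family_on_def simp del: Pair_inject prod.inject)
  then have "prob (\<Union>s\<in>?S. ?A s) = 1" using mass by simp
  then have "AE \<omega> in M. \<omega> \<in> (\<Union>s\<in>?S. ?A s)"
    by (subst (asm) prob_eq_1) (auto intro!: sets.finite_UN finite_joint_states A)
  then have ae: "AE \<omega> in M. (X \<omega>, Y \<omega>) \<in> ?S" by eventually_elim auto
  have "(\<integral>\<omega>. falling_factorial (real (Y \<omega>)) k * indicator {i} (X \<omega>) \<partial>M)
      = (\<Sum>m\<le>N. prob (?A (i, m)) * falling_factorial (real m) k)" for i
  proof -
    have "(\<integral>\<omega>. falling_factorial (real (Y \<omega>)) k * indicator {i} (X \<omega>) \<partial>M)
        = (\<integral>\<omega>. (\<Sum>m\<le>N. falling_factorial (real m) k * indicator (?A (i, m)) \<omega>) \<partial>M)"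
    proof (rule integral_cong_AE)
      show "(\<lambda>\<omega>. falling_factorial (real (Y \<omega>)) k * indicator {i} (X \<omega>)) \<in> borel_measurable M"
        using X Y by measurable
      show "(\<lambda>\<omega>. \<Sum>m\<le>N. falling_factorial (real m) k * indicator (?A (i, m)) \<omega>) \<in> borel_measurable M"
        using A by (intro borel_measurable_sum borel_measurable_times borel_measurable_indicator) auto
      show "AE \<omega> in M. falling_factorial (real (Y \<omega>)) k * indicator {i} (X \<omega>)
          = (\<Sum>m\<le>N. falling_factorial (real m) k * indicator (?A (i, m)) \<omega>)"
        using ae AE_space
      proof eventually_elim
        case (elim \<omega>)
        have "(\<Sum>m\<le>N. falling_factorial (real m) k * indicator (?A (i, m)) \<omega>)
            = (\<Sum>m\<le>N. if m = Y \<omega> then falling_factorial (real m) k * indicator {i} (X \<omega>) else 0)"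
          by (rule sum.cong) (use elim in \<open>auto simp: indicator_def\<close>)
        then show ?case using elim by (auto simp: joint_states_def)
      qed
    qed
    also have "\<dots> = (\<Sum>m\<le>N. \<integral>\<omega>. falling_factorial (real m) k * indicator (?A (i, m)) \<omega> \<partial>M)"
      by (rule Bochner_Integration.integral_sum)
         (intro integrable_mult_right integrable_real_indicator A, simp add: emeasure_eq_measure)
    also have "\<dots> = (\<Sum>m\<le>N. prob (?A (i, m)) * falling_factorial (real m) k)"
      using A by (auto intro!: sum.cong)
    finally show ?thesis .
  qed
  then show ?thesis
    by (simp add: factorial_moment_vector_def joint_moment_def)
qed

theorem proposition2p1:
  fixes Q :: "real^'d^'d" and lam mu pi_vec :: "real^'d" and N :: nat
    and M :: "'w measure" and X :: "'w \<Rightarrow> 'd" and Y :: "'w \<Rightarrow> nat"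
  assumes "rate_matrix UNIV (\<lambda>i j. Q $ i $ j)"
    and "irreducible_rates UNIV (\<lambda>i j. Q $ i $ j)"
    and "stationary_distribution UNIV (\<lambda>i j. Q $ i $ j) (\<lambda>i. pi_vec $ i)"
    and "\<And>i. 0 \<le> lam $ i" and "\<And>i. 0 \<le> mu $ i"
    and "\<exists>!p. stationary_distribution (joint_states N) (joint_rate_matrix Q lam mu N) p"
    and "prob_space M"
    and "X \<in> measurable M (count_space UNIV)" and "Y \<in> measurable M (count_space UNIV)"
    and "stationary_distribution (joint_states N) (joint_rate_matrix Q lam mu N)
           (\<lambda>s. measure M {\<omega> \<in> space M. (X \<omega>, Y \<omega>) = s})"
  shows "(\<forall>k\<in>{1..N}. invertible (shifted_mat Q lam mu k) \<and>
            factorial_moment_vector M X Y k =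
              (fact k * falling_factorial (real N) k) *\<^sub>R
                (pi_vec v* resolvent_product Q lam mu k))
         \<and> (\<forall>k\<ge>N + 1. factorial_moment_vector M X Y k = 0)"
proof -
  let ?p = "\<lambda>s. measure M {\<omega> \<in> space M. (X \<omega>, Y \<omega>) = s}"
  let ?e = "joint_moment N ?p"
  note rate = assms(1) and irred = assms(2)
  have mass: "(\<Sum>s\<in>joint_states N. ?p s) = 1"
    and bal: "\<forall>y\<in>joint_states N. (\<Sum>x\<in>joint_states N. ?p x * joint_rate_matrix Q lam mu N x y) = 0"
    using assms(10) unfolding stationary_distribution_iff_balance[OF finite_joint_states] by blast+
  have moment: "factorial_moment_vector M X Y k = ?e k" for k
    by (rule factorial_moment_vector_eq_joint_moment[OF assms(7-9) mass])
  have e0: "?e 0 = pi_vec"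
  proof (rule invariant_vector_unique[OF rate irred])
    show "?e 0 v* Q = 0"
      by (rule joint_moment_0_invariant[OF rate bal])
    show "(\<Sum>i\<in>UNIV. ?e 0 $ i) = 1"
      using mass by (simp add: joint_moment_def falling_factorial_0 sum_joint_states)
    show "pi_vec v* Q = 0" "(\<Sum>i\<in>UNIV. pi_vec $ i) = 1"
      using assms(3)
      by (auto simp: stationary_distribution_iff_balance vec_eq_iff vector_matrix_mult_def mult.commute)
  qed
  have inv: "invertible (shifted_mat Q lam mu k)" if k: "k \<in> {1..N}" for k
  proof -
    obtain a where a: "0 < lam $ a + mu $ a"
      using ex_positive_edge_rate[OF rate assms(3-6)] k by auto
    show ?thesis
      unfolding shifted_mat_eq
      by (rule invertible_diag_minus_rates[OF rate irred, of _ a]) (use a k assms(4,5) in auto)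
  qed
  have "?e k = (fact k * falling_factorial (real N) k) *\<^sub>R (pi_vec v* resolvent_product Q lam mu k)"
    if "k \<le> N" for k
    using that
  proof (induction k)
    case 0
    then show ?case by (simp add: e0 falling_factorial_0)
  next
    case (Suc k)
    let ?A = "shifted_mat Q lam mu (Suc k)"
    have "?e (Suc k) = ?e (Suc k) v* ?A v* matrix_inv ?A"
      using inv[of "Suc k"] Suc.prems
      by (simp add: vector_matrix_mul_assoc matrix_inv_right)
    also have "\<dots> = (real (Suc k) * (real N - real k)) *\<^sub>R (?e k v* diag_mat lam v* matrix_inv ?A)"
      by (simp add: joint_moment_recursion[OF rate bal] scaleR_vector_matrix_assoc del: of_nat_Suc)
    also have "?e k = (fact k * falling_factorial (real N) k) *\<^sub>R (pi_vec v* resolvent_product Q lam mu k)"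
      using Suc by simp
    finally show ?case
      by (simp add: falling_factorial_Suc scaleR_vector_matrix_assoc vector_matrix_mul_assoc mult_ac
          del: of_nat_Suc)
  qed
  then show ?thesis
    using inv by (auto simp: moment joint_moment_eq_0)
qed

end
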